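(* Let $\mathcal{J}$ be a complex $JB^*$-triple with norm $\|\cdot\|$ and triple product $\{xyz\}$. Let $f, h : \mathcal{J} \to \mathcal{J}$ be mappings with $f(0) = h(0) = 0$ for which there exists a function $\varphi : \mathcal{J}^3 \to [0,\infty)$ such that $$\widetilde{\varphi}(x,y,z) := \sum_{j=0}^{\infty} \frac{1}{3^j}\,\varphi(3^j x, 3^j y, 3^j z) < \infty,$$ $$\left\|2f\left(\tfrac{\mu x + y}{2}\right) - \mu f(x) - f(y)\right\| \le \varphi(x,y,0),$$ $$\left\|2h\left(\tfrac{\mu x + y}{2}\right) - \mu h(x) - h(y)\right\| \le \varphi(x,y,0),$$ $$\|f(\{xyz\}) - \{f(x)h(y)h(z)\} - \{h(x)f(y)h(z)\} - \{h(x)h(y)f(z)\}\| \le \varphi(x,y,z)$$ for all $x,y,z \in \mathcal{J}$ and all $\mu \in S^1 := \{\lambda \in \mathbb{C} : |\lambda| = 1\}$. Then there exist unique $\mathbb{C}$-linear mappings $D, \theta : \mathcal{J} \to \mathcal{J}$ such that $$\|f(x) - D(x)\| \le \tfrac13\big(\widetilde{\varphi}(x,-x,0) + \widetilde{\varphi}(-x,3x,0)\big),$$ $$\|h(x) - \theta(x)\| \le \tfrac13\big(\widetilde{\varphi}(x,-x,0) + \widetilde{\varphi}(-x,3x,0)\big)$$ for all $x \in \mathcal{J}$. Moreover, $D$ is a $\theta$-derivation on $\mathcal{J}$.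
   Context: A (complex) $JB^*$-triple is a complex Banach space $\mathcal{J}$ with a continuous triple product $\{\cdot,\cdot,\cdot\} : \mathcal{J}\times\mathcal{J}\times\mathcal{J} \to \mathcal{J}$ (also written $\{xyz\} = \{x,y,z\}$), linear in the outer variables and conjugate linear in the middle variable, such that: (i) $\{x,y,z\} = \{z,y,x\}$; (ii) with $L(a,b)x := \{a,b,x\}$, $L(a,b)\{x,y,z\} = \{L(a,b)x,y,z\} - \{x,L(b,a)y,z\} + \{x,y,L(a,b)z\}$ for all $a,b,x,y,z\in\mathcal{J}$; (iii) for all $a \in \mathcal{J}$ the operator $L(a,a)$ is hermitian, i.e. $\|e^{itL(a,a)}\| = 1$ for all $t \in \mathbb{R}$, and has positive (i.e. contained in $[0,\infty)$) spectrum in the Banach algebra $B(\mathcal{J})$ of bounded linear operators on $\mathcal{J}$; (iv) $\|\{x,x,x\}\| = \|x\|^3$ for all $x \in \mathcal{J}$. Given a $\mathbb{C}$-linear mapping $\theta : \mathcal{J} \to \mathcal{J}$, a $\mathbb{C}$-linear mapping $D : \mathcal{J} \to \mathcal{J}$ is called a $\theta$-derivation on $\mathcal{J}$ if $D(\{xyz\}) = \{D(x)\theta(y)\theta(z)\} + \{\theta(x)D(y)\theta(z)\} + \{\theta(x)\theta(y)D(z)\}$ for all $x,y,z \in \mathcal{J}$. No continuity of $D$ or $\theta$ is assumed. *)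

theory Defs
  imports "HOL-Analysis.Analysis"
begin

text \<open>The library has no complex Banach spaces, so the complex scalar multiplication is a
  parameter on a real Banach space; it extends the real one and the norm is homogeneous for it.\<close>

locale complex_banach = vector_space cscale
  for cscale :: "complex \<Rightarrow> 'a::banach \<Rightarrow> 'a" (infixr "*\<^sub>C" 75) +
  assumes cscale_of_real: "complex_of_real r *\<^sub>C x = r *\<^sub>R x"
    and norm_cscale: "norm (c *\<^sub>C x) = cmod c * norm x"

definition bounded_clinear_op :: "(complex \<Rightarrow> 'a::banach \<Rightarrow> 'a) \<Rightarrow> ('a \<Rightarrow> 'a) \<Rightarrow> bool" where
  "bounded_clinear_op cscale T \<longleftrightarrow> bounded_linear T \<and> Vector_Spaces.linear cscale cscale T"

text \<open>For bounded \<open>T\<close> the exponential series converges absolutely in operator norm, so its sum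
  can be computed pointwise.\<close>

definition op_exp :: "('a::banach \<Rightarrow> 'a) \<Rightarrow> 'a \<Rightarrow> 'a" where
  "op_exp T x = (\<Sum>n. (T ^^ n) x /\<^sub>R fact n)"

definition hermitian_op :: "(complex \<Rightarrow> 'a::banach \<Rightarrow> 'a) \<Rightarrow> ('a \<Rightarrow> 'a) \<Rightarrow> bool" where
  "hermitian_op cscale T \<longleftrightarrow>
     (\<forall>t::real. onorm (op_exp (\<lambda>x. cscale (\<i> * complex_of_real t) (T x))) = 1)"

text \<open>Invertibility is taken in the algebra of bounded complex-linear operators.\<close>

definition op_spectrum :: "(complex \<Rightarrow> 'a::banach \<Rightarrow> 'a) \<Rightarrow> ('a \<Rightarrow> 'a) \<Rightarrow> complex set" where
  "op_spectrum cscale T =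
     {c. \<not> (\<exists>S. bounded_clinear_op cscale S \<and>
            (\<lambda>x. cscale c x - T x) \<circ> S = id \<and> S \<circ> (\<lambda>x. cscale c x - T x) = id)}"

locale jb_star_triple = complex_banach cscale
  for cscale :: "complex \<Rightarrow> 'a::banach \<Rightarrow> 'a" (infixr "*\<^sub>C" 75) +
  fixes triple :: "'a \<Rightarrow> 'a \<Rightarrow> 'a \<Rightarrow> 'a" ("\<lbrace>_,_,_\<rbrace>")
  assumes triple_continuous: "continuous_on UNIV (\<lambda>(x, y, z). \<lbrace>x, y, z\<rbrace>)"
    and triple_linear_left: "Vector_Spaces.linear cscale cscale (\<lambda>x. \<lbrace>x, y, z\<rbrace>)"
    and triple_linear_right: "Vector_Spaces.linear cscale cscale (\<lambda>z. \<lbrace>x, y, z\<rbrace>)"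
    and triple_add_middle: "\<lbrace>x, y + y', z\<rbrace> = \<lbrace>x, y, z\<rbrace> + \<lbrace>x, y', z\<rbrace>"
    and triple_cscale_middle: "\<lbrace>x, c *\<^sub>C y, z\<rbrace> = cnj c *\<^sub>C \<lbrace>x, y, z\<rbrace>"
    and triple_commute: "\<lbrace>x, y, z\<rbrace> = \<lbrace>z, y, x\<rbrace>"
    and jordan_identity:
      "\<lbrace>a, b, \<lbrace>x, y, z\<rbrace>\<rbrace> =
         \<lbrace>\<lbrace>a, b, x\<rbrace>, y, z\<rbrace> - \<lbrace>x, \<lbrace>b, a, y\<rbrace>, z\<rbrace> + \<lbrace>x, y, \<lbrace>a, b, z\<rbrace>\<rbrace>"
    and hermitian: "hermitian_op cscale (\<lambda>x. \<lbrace>a, a, x\<rbrace>)"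
    and positive_spectrum: "op_spectrum cscale (\<lambda>x. \<lbrace>a, a, x\<rbrace>) \<subseteq> complex_of_real ` {0..}"
    and norm_cube: "norm \<lbrace>x, x, x\<rbrace> = norm x ^ 3"

definition theta_derivation ::
  "(complex \<Rightarrow> 'a::banach \<Rightarrow> 'a) \<Rightarrow> ('a \<Rightarrow> 'a \<Rightarrow> 'a \<Rightarrow> 'a) \<Rightarrow> ('a \<Rightarrow> 'a) \<Rightarrow> ('a \<Rightarrow> 'a) \<Rightarrow> bool" where
  "theta_derivation cscale triple \<theta> D \<longleftrightarrow>
     Vector_Spaces.linear cscale cscale \<theta> \<and> Vector_Spaces.linear cscale cscale D \<and>
     (\<forall>x y z. D (triple x y z) =
        triple (D x) (\<theta> y) (\<theta> z) + triple (\<theta> x) (D y) (\<theta> z) + triple (\<theta> x) (\<theta> y) (D z))"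

text \<open>Finiteness of the series is stated separately, as summability of \<open>control_term\<close>.\<close>

definition control_term ::
  "('a::real_vector \<Rightarrow> 'a \<Rightarrow> 'a \<Rightarrow> real) \<Rightarrow> 'a \<Rightarrow> 'a \<Rightarrow> 'a \<Rightarrow> nat \<Rightarrow> real" where
  "control_term \<phi> x y z j = 1 / 3 ^ j * \<phi> (3 ^ j *\<^sub>R x) (3 ^ j *\<^sub>R y) (3 ^ j *\<^sub>R z)"

definition control_sum ::
  "('a::real_vector \<Rightarrow> 'a \<Rightarrow> 'a \<Rightarrow> real) \<Rightarrow> 'a \<Rightarrow> 'a \<Rightarrow> 'a \<Rightarrow> real" where
  "control_sum \<phi> x y z = (\<Sum>j. control_term \<phi> x y z j)"

end

theory Submission
  imports Defs
begin

text \<open>Taking \<open>\<mu> = 1\<close> at the pairs \<open>(x, -x)\<close> and \<open>(-x, 3x)\<close> bounds the distance of \<open>f (3x)\<close> from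
  \<open>3 f x\<close>, so \<open>f (3\<^sup>n x) / 3\<^sup>n\<close> converges to some \<open>D x\<close> (Hyers' method), and the telescoping series gives
  the estimate. The defect in the Jensen-type inequality disappears in the limit, so \<open>D\<close> is additive
  and commutes with unit scalars; every scalar is an integer multiple of a sum of two unit scalars,
  so \<open>D\<close> is complex linear. A linear map within the stated distance of \<open>f\<close> has to be the same limit,
  because the distance at \<open>3\<^sup>n x\<close>, divided by \<open>3\<^sup>n\<close>, is a tail of a convergent series. Evaluating the
  triple product inequality at \<open>3\<^sup>n x\<close>, \<open>3\<^sup>n y\<close>, \<open>3\<^sup>n z\<close> and dividing by \<open>27\<^sup>n\<close> yields the derivation identity.\<close>

section \<open>Control series, telescoping and unit complex numbers\<close>

lemma control_term_scale:
  "control_term \<phi> (3 ^ n *\<^sub>R x) (3 ^ n *\<^sub>R y) (3 ^ n *\<^sub>R z) j = 3 ^ n * control_term \<phi> x y z (j + n)"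
  by (simp add: control_term_def power_add)

lemma norm_divide_power3: "norm (x /\<^sub>R 3 ^ n) = norm x / 3 ^ n"
  by (simp add: divide_inverse mult.commute)

text \<open>Multiplying the arguments by \<open>3 ^ n\<close> and dividing the sum by
  \<open>3 ^ n\<close> only shifts the summation index, so the quotient is the tail of a convergent
  series from index \<open>n\<close> on.\<close>

lemma control_sum_scale_tendsto_0:
  assumes "summable (control_term \<phi> x y z)"
  shows "(\<lambda>n. control_sum \<phi> (3 ^ n *\<^sub>R x) (3 ^ n *\<^sub>R y) (3 ^ n *\<^sub>R z) / 3 ^ n) \<longlonglongrightarrow> 0"
proof -
  have "control_sum \<phi> (3 ^ n *\<^sub>R x) (3 ^ n *\<^sub>R y) (3 ^ n *\<^sub>R z) / 3 ^ n
      = suminf (control_term \<phi> x y z) - (\<Sum>j<n. control_term \<phi> x y z j)" for n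
  proof -
    have "summable (\<lambda>j. control_term \<phi> x y z (j + n))"
      using assms by (simp add: summable_iff_shift)
    then have "control_sum \<phi> (3 ^ n *\<^sub>R x) (3 ^ n *\<^sub>R y) (3 ^ n *\<^sub>R z)
        = 3 ^ n * (\<Sum>j. control_term \<phi> x y z (j + n))"
      by (simp add: control_sum_def control_term_scale suminf_mult)
    then show ?thesis
      using suminf_minus_initial_segment[OF assms, of n] by simp
  qed
  moreover have "(\<lambda>n. suminf (control_term \<phi> x y z) - (\<Sum>j<n. control_term \<phi> x y z j)) \<longlonglongrightarrow> 0"
    using tendsto_diff[OF tendsto_const[of "suminf (control_term \<phi> x y z)"] summable_LIMSEQ[OF assms]]
    by simp
  ultimately show ?thesis by simp
qed

text \<open>The increments are absolutely summable by comparison with \<open>b\<close>, and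
  completeness makes their telescoping series converge. The norm of its sum is the distance from
  \<open>g 0\<close> to the limit.\<close>

lemma tendsto_of_summable_diff:
  fixes g :: "nat \<Rightarrow> 'a::banach"
  assumes b: "summable b" and le: "\<And>n. norm (g (Suc n) - g n) \<le> b n"
  obtains l where "g \<longlonglongrightarrow> l" and "norm (g 0 - l) \<le> suminf b"
proof
  let ?s = "\<Sum>n. g (Suc n) - g n"
  have sn: "summable (\<lambda>n. norm (g (Suc n) - g n))"
    by (rule summable_comparison_test'[OF b]) (use le in auto)
  have "(\<lambda>n. g n - g 0) \<longlonglongrightarrow> ?s"
    using summable_LIMSEQ[OF summable_norm_cancel[OF sn]] by (simp add: sum_lessThan_telescope)
  from tendsto_add[OF this tendsto_const[of "g 0"]] show "g \<longlonglongrightarrow> ?s + g 0" by simp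
  have "norm ?s \<le> (\<Sum>n. norm (g (Suc n) - g n))" by (rule summable_norm[OF sn])
  also have "\<dots> \<le> suminf b" by (rule suminf_le[OF le sn b])
  finally show "norm (g 0 - (?s + g 0)) \<le> suminf b" by simp
qed

text \<open>Unit vectors at angle \<open>?a\<close> on either side of the direction of
  \<open>c\<close> add up to a vector in that direction of length \<open>2 * cos ?a\<close>; the
  arccosine makes this length \<open>cmod c\<close>.\<close>

lemma sum_of_two_unit_complex:
  assumes "cmod c \<le> 2"
  obtains \<mu> \<nu> where "cmod \<mu> = 1" "cmod \<nu> = 1" "c = \<mu> + \<nu>"
proof
  let ?t = "Arg c" and ?a = "arccos (cmod c / 2)"
  have "cos ?a = cmod c / 2" by (rule cos_arccos) (use assms norm_ge_zero[of c] in linarith)+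
  then have "cis (?t + ?a) + cis (?t - ?a) = complex_of_real (cmod c) * cis ?t"
    by (simp add: complex_eq_iff cos_add cos_diff sin_add sin_diff)
  then show "c = cis (?t + ?a) + cis (?t - ?a)"
    using rcis_cmod_Arg[of c] by (simp add: rcis_def)
qed simp_all

section \<open>Complex linear maps and Hyers limits\<close>

context complex_banach
begin

lemma cscale_scaleR: "c *\<^sub>C (r *\<^sub>R x) = r *\<^sub>R (c *\<^sub>C x)"
  by (simp flip: cscale_of_real add: mult.commute)

lemma linear_scaleR:
  assumes "Vector_Spaces.linear cscale cscale T"
  shows "T (r *\<^sub>R x) = r *\<^sub>R T x"
proof -
  interpret T: Vector_Spaces.linear cscale cscale T by fact
  show ?thesis by (metis T.scale cscale_of_real)
qed

lemma bounded_linear_cscale: "bounded_linear (\<lambda>x. c *\<^sub>C x)"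
  by (rule bounded_linear_intro[where K = "cmod c"])
    (simp_all add: scale_right_distrib cscale_scaleR norm_cscale mult.commute)

lemma linear_if_commutes_with_unit_scalars:
  assumes add: "\<And>x y. T (x + y) = T x + T y"
    and unit: "\<And>\<mu> x. cmod \<mu> = 1 \<Longrightarrow> T (\<mu> *\<^sub>C x) = \<mu> *\<^sub>C T x"
  shows "Vector_Spaces.linear cscale cscale T"
proof -
  have small: "T (c *\<^sub>C x) = c *\<^sub>C T x" if "cmod c \<le> 2" for c x
  proof -
    from that obtain \<mu> \<nu> where "cmod \<mu> = 1" "cmod \<nu> = 1" "c = \<mu> + \<nu>"
      by (rule sum_of_two_unit_complex)
    then show ?thesis by (simp add: scale_left_distrib add unit)
  qed
  have T0: "T 0 = 0" using add[of 0 0] by simp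
  have nat: "T (of_nat n *\<^sub>C x) = of_nat n *\<^sub>C T x" for n x
    by (induction n) (simp_all add: T0 scale_left_distrib add)
  have "T (c *\<^sub>C x) = c *\<^sub>C T x" for c x
  proof -
    \<comment> \<open>A strict bound keeps \<open>n\<close> positive even for \<open>c = 0\<close>,
      so division by \<open>n\<close> is legitimate, and \<open>c / of_nat n\<close> falls within
      the range of \<open>small\<close>.\<close>
    obtain n :: nat where n: "cmod c < real n" using reals_Archimedean2 by blast
    then have "0 < real n" using norm_ge_zero[of c] by linarith
    then have c: "c = of_nat n * (c / of_nat n)" by simp
    have "cmod (c / of_nat n) \<le> 2"
      using n \<open>0 < real n\<close> by (simp add: norm_divide field_simps)
    then have "T (of_nat n *\<^sub>C (c / of_nat n) *\<^sub>C x) = of_nat n *\<^sub>C (c / of_nat n) *\<^sub>C T x"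
      by (simp only: nat small)
    then show ?thesis by (metis c scale_scale)
  qed
  with add show ?thesis
    by unfold_locales
qed

text \<open>One predicate for the estimate shared by \<open>D\<close> and \<theta>, so that
  existence and uniqueness are proved once and applied to both \<open>f\<close> and
  \<open>h\<close>.\<close>

definition approximates :: "('a \<Rightarrow> 'a \<Rightarrow> 'a \<Rightarrow> real) \<Rightarrow> ('a \<Rightarrow> 'a) \<Rightarrow> ('a \<Rightarrow> 'a) \<Rightarrow> bool" where
  "approximates \<phi> f D \<longleftrightarrow> (\<forall>x. norm (f x - D x) \<le>
     1 / 3 * (control_sum \<phi> x (- x) 0 + control_sum \<phi> (- x) (3 *\<^sub>R x) 0))"

text \<open>The sequence does not mention \<open>D\<close>, which gives uniqueness; the same limits
  later feed the derivation identity. Linearity turns the error at stage \<open>n\<close> into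
  \<open>f - D\<close> evaluated at \<open>3 ^ n *\<^sub>R x\<close> and divided by
  \<open>3 ^ n\<close>.\<close>

lemma tendsto_linear_approximation:
  assumes summable: "\<And>x y z. summable (control_term \<phi> x y z)"
    and lin: "Vector_Spaces.linear cscale cscale D"
    and approx: "approximates \<phi> f D"
  shows "(\<lambda>n. f (3 ^ n *\<^sub>R x) /\<^sub>R 3 ^ n) \<longlonglongrightarrow> D x"
proof -
  \<comment> \<open>The factor \<open>3 ^ n\<close> stands in front of every argument, even of
    \<open>0\<close>, to match \<open>control_sum_scale_tendsto_0\<close>.\<close>
  let ?c = "\<lambda>n. 1 / 3 * (control_sum \<phi> (3 ^ n *\<^sub>R x) (3 ^ n *\<^sub>R (- x)) (3 ^ n *\<^sub>R 0) / 3 ^ n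
      + control_sum \<phi> (3 ^ n *\<^sub>R (- x)) (3 ^ n *\<^sub>R (3 *\<^sub>R x)) (3 ^ n *\<^sub>R 0) / 3 ^ n)"
  have c: "?c \<longlonglongrightarrow> 0"
    by (intro tendsto_mult_right_zero tendsto_add_zero control_sum_scale_tendsto_0 summable)
  have "norm (f (3 ^ n *\<^sub>R x) /\<^sub>R 3 ^ n - D x) \<le> ?c n" for n
  proof -
    have "f (3 ^ n *\<^sub>R x) /\<^sub>R 3 ^ n - D x = (f (3 ^ n *\<^sub>R x) - D (3 ^ n *\<^sub>R x)) /\<^sub>R 3 ^ n"
      by (simp add: linear_scaleR[OF lin] scaleR_diff_right)
    then have "norm (f (3 ^ n *\<^sub>R x) /\<^sub>R 3 ^ n - D x)
        = norm (f (3 ^ n *\<^sub>R x) - D (3 ^ n *\<^sub>R x)) / 3 ^ n"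
      by (simp only: norm_divide_power3)
    also have "\<dots> \<le> 1 / 3 * (control_sum \<phi> (3 ^ n *\<^sub>R x) (- (3 ^ n *\<^sub>R x)) 0
        + control_sum \<phi> (- (3 ^ n *\<^sub>R x)) (3 *\<^sub>R 3 ^ n *\<^sub>R x) 0) / 3 ^ n"
      by (intro divide_right_mono approx[unfolded approximates_def, rule_format]) simp
    also have "\<dots> = ?c n" by (simp add: add_divide_distrib mult.commute)
    finally show ?thesis .
  qed
  then have "(\<lambda>n. f (3 ^ n *\<^sub>R x) /\<^sub>R 3 ^ n - D x) \<longlonglongrightarrow> 0"
    by (intro Lim_null_comparison[OF _ c] always_eventually allI)
  then show ?thesis by (rule LIM_zero_cancel)
qed

lemma ex_linear_approximation:
  assumes zero: "f 0 = 0"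
    and summable: "\<And>x y z. summable (control_term \<phi> x y z)"
    and jensen: "\<And>\<mu> x y. cmod \<mu> = 1 \<Longrightarrow>
      norm (2 *\<^sub>R f ((1 / 2) *\<^sub>R (\<mu> *\<^sub>C x + y)) - \<mu> *\<^sub>C f x - f y) \<le> \<phi> x y 0"
  obtains D where "Vector_Spaces.linear cscale cscale D" and "approximates \<phi> f D"
proof -
  \<comment> \<open>The pair \<open>(x, -x)\<close> has midpoint \<open>0\<close>, where
    \<open>f\<close> vanishes, and \<open>(-x, 3x)\<close> has midpoint \<open>x\<close>.
    Subtracting the two defects cancels \<open>f (- x)\<close>.\<close>
  have step: "norm (f (3 *\<^sub>R x) - 3 *\<^sub>R f x) \<le> \<phi> x (- x) 0 + \<phi> (- x) (3 *\<^sub>R x) 0" for x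
  proof -
    have "- x + 3 *\<^sub>R x = 2 *\<^sub>R x"
      using scaleR_left_distrib[of "-1" 3 x] by simp
    then have half: "(1 / 2) *\<^sub>R (- x + 3 *\<^sub>R x) = x"
      by (simp only: scaleR_scaleR) simp
    have "norm (- f x - f (- x)) \<le> \<phi> x (- x) 0"
      using jensen[of 1 x "- x"] by (simp add: zero)
    moreover have "norm (2 *\<^sub>R f x - f (- x) - f (3 *\<^sub>R x)) \<le> \<phi> (- x) (3 *\<^sub>R x) 0"
      using jensen[of 1 "- x" "3 *\<^sub>R x"] by (simp only: scale_one half norm_one)
    moreover have "f (3 *\<^sub>R x) - 3 *\<^sub>R f x
        = (- f x - f (- x)) - (2 *\<^sub>R f x - f (- x) - f (3 *\<^sub>R x))"
      using scaleR_left_distrib[of 1 2 "f x"] by (simp add: algebra_simps)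
    ultimately show ?thesis
      by (simp only: order_trans[OF norm_triangle_ineq4 add_mono])
  qed
  \<comment> \<open>This is the bound of \<open>step\<close> at \<open>3 ^ n *\<^sub>R x\<close>
    divided by \<open>3 ^ Suc n\<close>; the extra division by 3 is the source of the factor 1/3 in
    the estimate.\<close>
  define b where
    "b x = (\<lambda>n. 1 / 3 * (control_term \<phi> x (- x) 0 n + control_term \<phi> (- x) (3 *\<^sub>R x) 0 n))" for x
  have b: "summable (b x)"
    and sum_b: "suminf (b x) = 1 / 3 * (control_sum \<phi> x (- x) 0 + control_sum \<phi> (- x) (3 *\<^sub>R x) 0)"
    for x
    unfolding b_def control_sum_def
    by (rule summable_mult[OF summable_add[OF summable summable]])
      (simp only: suminf_mult suminf_add summable summable_add)
  have "\<exists>l. (\<lambda>n. f (3 ^ n *\<^sub>R x) /\<^sub>R 3 ^ n) \<longlonglongrightarrow> l \<and> norm (f x - l) \<le> suminf (b x)" for x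
  proof -
    have le: "norm (f (3 ^ Suc n *\<^sub>R x) /\<^sub>R 3 ^ Suc n - f (3 ^ n *\<^sub>R x) /\<^sub>R 3 ^ n) \<le> b x n" for n
    proof -
      have "f (3 ^ Suc n *\<^sub>R x) /\<^sub>R 3 ^ Suc n - f (3 ^ n *\<^sub>R x) /\<^sub>R 3 ^ n
          = (f (3 *\<^sub>R 3 ^ n *\<^sub>R x) - 3 *\<^sub>R f (3 ^ n *\<^sub>R x)) /\<^sub>R 3 ^ Suc n"
        by (simp add: scaleR_diff_right)
      then have "norm (f (3 ^ Suc n *\<^sub>R x) /\<^sub>R 3 ^ Suc n - f (3 ^ n *\<^sub>R x) /\<^sub>R 3 ^ n)
          = norm (f (3 *\<^sub>R 3 ^ n *\<^sub>R x) - 3 *\<^sub>R f (3 ^ n *\<^sub>R x)) / 3 ^ Suc n"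
        by (simp only: norm_divide_power3)
      also have "\<dots> \<le> (\<phi> (3 ^ n *\<^sub>R x) (- (3 ^ n *\<^sub>R x)) 0
          + \<phi> (- (3 ^ n *\<^sub>R x)) (3 *\<^sub>R 3 ^ n *\<^sub>R x) 0) / 3 ^ Suc n"
        by (intro divide_right_mono step) simp
      also have "\<dots> = b x n"
        by (simp add: b_def control_term_def field_simps)
      finally show ?thesis .
    qed
    \<comment> \<open>The sequence starts at \<open>f x\<close>, since \<open>3 ^ 0 = 1\<close>, so
      the distance from its initial member is the required one.\<close>
    show ?thesis
      using tendsto_of_summable_diff[where g = "\<lambda>n. f (3 ^ n *\<^sub>R x) /\<^sub>R 3 ^ n", OF b[of x] le]
      by auto
  qed
  then obtain D where lim: "\<And>x. (\<lambda>n. f (3 ^ n *\<^sub>R x) /\<^sub>R 3 ^ n) \<longlonglongrightarrow> D x"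
    and D: "\<And>x. norm (f x - D x) \<le> suminf (b x)"
    by metis
  have jensen_D: "2 *\<^sub>R D ((1 / 2) *\<^sub>R (\<mu> *\<^sub>C x + y)) = \<mu> *\<^sub>C D x + D y" if \<mu>: "cmod \<mu> = 1" for \<mu> x y
  proof -
    let ?g = "\<lambda>n x. f (3 ^ n *\<^sub>R x) /\<^sub>R 3 ^ n"
    let ?d = "\<lambda>n. 2 *\<^sub>R ?g n ((1 / 2) *\<^sub>R (\<mu> *\<^sub>C x + y)) - \<mu> *\<^sub>C ?g n x - ?g n y"
    have "?d \<longlonglongrightarrow> 2 *\<^sub>R D ((1 / 2) *\<^sub>R (\<mu> *\<^sub>C x + y)) - \<mu> *\<^sub>C D x - D y"
      by (intro tendsto_intros lim bounded_linear.tendsto[OF bounded_linear_cscale])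
    \<comment> \<open>\<open>?d n\<close> is the Jensen defect of \<open>f\<close> at the scaled
      points divided by \<open>3 ^ n\<close>, hence bounded by a term of a summable series.\<close>
    moreover have "?d \<longlonglongrightarrow> 0"
    proof (rule Lim_null_comparison)
      show "control_term \<phi> x y 0 \<longlonglongrightarrow> 0" by (rule summable_LIMSEQ_zero[OF summable])
      show "\<forall>\<^sub>F n in sequentially. norm (?d n) \<le> control_term \<phi> x y 0 n"
      proof (intro always_eventually allI)
        fix n
        have arg: "3 ^ n *\<^sub>R (1 / 2) *\<^sub>R (\<mu> *\<^sub>C x + y)
            = (1 / 2) *\<^sub>R (\<mu> *\<^sub>C (3 ^ n *\<^sub>R x) + 3 ^ n *\<^sub>R y)"
          by (simp add: cscale_scaleR scaleR_add_right mult.commute)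
        have "?d n = (2 *\<^sub>R f ((1 / 2) *\<^sub>R (\<mu> *\<^sub>C (3 ^ n *\<^sub>R x) + 3 ^ n *\<^sub>R y))
            - \<mu> *\<^sub>C f (3 ^ n *\<^sub>R x) - f (3 ^ n *\<^sub>R y)) /\<^sub>R 3 ^ n"
          unfolding arg by (simp add: cscale_scaleR scaleR_diff_right mult.commute)
        then have "norm (?d n) = norm (2 *\<^sub>R f ((1 / 2) *\<^sub>R (\<mu> *\<^sub>C (3 ^ n *\<^sub>R x) + 3 ^ n *\<^sub>R y))
            - \<mu> *\<^sub>C f (3 ^ n *\<^sub>R x) - f (3 ^ n *\<^sub>R y)) / 3 ^ n"
          by (simp only: norm_divide_power3)
        also have "\<dots> \<le> \<phi> (3 ^ n *\<^sub>R x) (3 ^ n *\<^sub>R y) 0 / 3 ^ n"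
          by (intro divide_right_mono jensen \<mu>) simp
        finally show "norm (?d n) \<le> control_term \<phi> x y 0 n" by (simp add: control_term_def)
      qed
    qed
    ultimately have "2 *\<^sub>R D ((1 / 2) *\<^sub>R (\<mu> *\<^sub>C x + y)) - \<mu> *\<^sub>C D x - D y = 0"
      by (rule LIMSEQ_unique)
    then show ?thesis by (simp add: algebra_simps)
  qed
  have D0: "D 0 = 0"
    using LIMSEQ_unique[OF lim[of 0]] by (simp add: zero)
  \<comment> \<open>This removes the midpoint from \<open>jensen_D\<close>: the case \<mu> = 1 then
    yields additivity, and the case \<open>y = 0\<close> compatibility with unit scalars.\<close>
  have half: "2 *\<^sub>R D ((1 / 2) *\<^sub>R x) = D x" for x
    using jensen_D[of 1 0 x] by (simp add: D0)
  have "Vector_Spaces.linear cscale cscale D"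
  proof (rule linear_if_commutes_with_unit_scalars)
    show "D (x + y) = D x + D y" for x y
      using jensen_D[of 1 x y] half[of "x + y"] by simp
    show "D (\<mu> *\<^sub>C x) = \<mu> *\<^sub>C D x" if "cmod \<mu> = 1" for \<mu> x
      using jensen_D[OF that, of x 0] half[of "\<mu> *\<^sub>C x"] by (simp add: D0)
  qed
  moreover have "approximates \<phi> f D"
    using D by (simp add: approximates_def sum_b)
  ultimately show thesis by (rule that)
qed

end

section \<open>Scaling and limits of the triple product\<close>

context jb_star_triple
begin

text \<open>Conjugation in the middle variable fixes real scalars, so all three factors come out
  unchanged.\<close>

lemma triple_scaleR: "\<lbrace>r *\<^sub>R x, s *\<^sub>R y, t *\<^sub>R z\<rbrace> = (r * s * t) *\<^sub>R \<lbrace>x, y, z\<rbrace>"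
proof -
  have "\<lbrace>x, s *\<^sub>R y, z\<rbrace> = s *\<^sub>R \<lbrace>x, y, z\<rbrace>" for x y z
    using triple_cscale_middle[of x "complex_of_real s" y z] by (simp add: cscale_of_real)
  then show ?thesis
    by (simp add: linear_scaleR[OF triple_linear_left] linear_scaleR[OF triple_linear_right] ac_simps)
qed

lemma tendsto_triple:
  assumes "(f \<longlongrightarrow> a) F" "(g \<longlongrightarrow> b) F" "(h \<longlongrightarrow> c) F"
  shows "((\<lambda>n. \<lbrace>f n, g n, h n\<rbrace>) \<longlongrightarrow> \<lbrace>a, b, c\<rbrace>) F"
proof -
  have "isCont (\<lambda>(x, y, z). \<lbrace>x, y, z\<rbrace>) (a, b, c)"
    using triple_continuous by (simp add: continuous_on_eq_continuous_at)
  from isCont_tendsto_compose[OF this tendsto_Pair[OF assms(1) tendsto_Pair[OF assms(2,3)]]]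
  show ?thesis by simp
qed

lemma derivation_identity_of_limits:
  assumes nonneg: "\<And>x y z. 0 \<le> \<phi> x y z"
    and summable: "\<And>x y z. summable (control_term \<phi> x y z)"
    and defect: "\<And>x y z.
      norm (f \<lbrace>x, y, z\<rbrace> - \<lbrace>f x, h y, h z\<rbrace> - \<lbrace>h x, f y, h z\<rbrace> - \<lbrace>h x, h y, f z\<rbrace>) \<le> \<phi> x y z"
    and f: "\<And>x. (\<lambda>n. f (3 ^ n *\<^sub>R x) /\<^sub>R 3 ^ n) \<longlonglongrightarrow> D x"
    and h: "\<And>x. (\<lambda>n. h (3 ^ n *\<^sub>R x) /\<^sub>R 3 ^ n) \<longlonglongrightarrow> \<theta> x"
  shows "D \<lbrace>x, y, z\<rbrace> = \<lbrace>D x, \<theta> y, \<theta> z\<rbrace> + \<lbrace>\<theta> x, D y, \<theta> z\<rbrace> + \<lbrace>\<theta> x, \<theta> y, D z\<rbrace>"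
proof -
  let ?f = "\<lambda>n x. f (3 ^ n *\<^sub>R x) /\<^sub>R 3 ^ n" and ?h = "\<lambda>n x. h (3 ^ n *\<^sub>R x) /\<^sub>R 3 ^ n"
  \<comment> \<open>The first term runs along the subsequence \<open>3 * n\<close> because scaling
    all three arguments by \<open>3 ^ n\<close> scales the triple product by
    \<open>3 ^ (3 * n)\<close>.\<close>
  let ?d = "\<lambda>n. ?f (3 * n) \<lbrace>x, y, z\<rbrace> - \<lbrace>?f n x, ?h n y, ?h n z\<rbrace> - \<lbrace>?h n x, ?f n y, ?h n z\<rbrace>
      - \<lbrace>?h n x, ?h n y, ?f n z\<rbrace>"
  have "(\<lambda>n. ?f (3 * n) \<lbrace>x, y, z\<rbrace>) \<longlonglongrightarrow> D \<lbrace>x, y, z\<rbrace>"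
    using LIMSEQ_subseq_LIMSEQ[OF f[of "\<lbrace>x, y, z\<rbrace>"], of "\<lambda>n. 3 * n"]
    by (simp add: strict_mono_def o_def)
  then have "?d \<longlonglongrightarrow> D \<lbrace>x, y, z\<rbrace> - \<lbrace>D x, \<theta> y, \<theta> z\<rbrace> - \<lbrace>\<theta> x, D y, \<theta> z\<rbrace> - \<lbrace>\<theta> x, \<theta> y, D z\<rbrace>"
    by (intro tendsto_diff tendsto_triple f h)
  moreover have "?d \<longlonglongrightarrow> 0"
  proof (rule Lim_null_comparison)
    show "control_term \<phi> x y z \<longlonglongrightarrow> 0" by (rule summable_LIMSEQ_zero[OF summable])
    show "\<forall>\<^sub>F n in sequentially. norm (?d n) \<le> control_term \<phi> x y z n"
    proof (intro always_eventually allI)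
      fix n
      let ?x = "3 ^ n *\<^sub>R x" and ?y = "3 ^ n *\<^sub>R y" and ?z = "3 ^ n *\<^sub>R z"
      let ?e = "f \<lbrace>?x, ?y, ?z\<rbrace> - \<lbrace>f ?x, h ?y, h ?z\<rbrace> - \<lbrace>h ?x, f ?y, h ?z\<rbrace> - \<lbrace>h ?x, h ?y, f ?z\<rbrace>"
      have p: "(3::real) ^ (3 * n) = 3 ^ n * 3 ^ n * 3 ^ n"
        by (simp add: power_add[symmetric])
      have "?d n = ?e /\<^sub>R 3 ^ (3 * n)"
        by (simp only: p triple_scaleR scaleR_diff_right inverse_mult_distrib)
      then have "norm (?d n) = norm ?e / 3 ^ (3 * n)"
        by (simp only: norm_divide_power3)
      also have "\<dots> \<le> \<phi> ?x ?y ?z / 3 ^ (3 * n)"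
        by (intro divide_right_mono defect) simp
      \<comment> \<open>Nonnegativity of \<phi> allows the denominator to shrink to
        \<open>3 ^ n\<close>, which turns the bound into a control term.\<close>
      also have "\<dots> \<le> \<phi> ?x ?y ?z / 3 ^ n"
        by (intro divide_left_mono nonneg) (simp_all add: power_increasing)
      finally show "norm (?d n) \<le> control_term \<phi> x y z n" by (simp add: control_term_def)
    qed
  qed
  ultimately have "D \<lbrace>x, y, z\<rbrace> - \<lbrace>D x, \<theta> y, \<theta> z\<rbrace> - \<lbrace>\<theta> x, D y, \<theta> z\<rbrace> - \<lbrace>\<theta> x, \<theta> y, D z\<rbrace> = 0"
    by (rule LIMSEQ_unique)
  then show ?thesis by (simp add: algebra_simps)
qed

end

theorem theorem2p3:
  fixes cscale :: "complex \<Rightarrow> 'a::banach \<Rightarrow> 'a" (infixr "*\<^sub>C" 75)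
    and triple :: "'a \<Rightarrow> 'a \<Rightarrow> 'a \<Rightarrow> 'a" ("\<lbrace>_,_,_\<rbrace>")
    and f h :: "'a \<Rightarrow> 'a"
    and \<phi> :: "'a \<Rightarrow> 'a \<Rightarrow> 'a \<Rightarrow> real"
  assumes "jb_star_triple cscale triple"
    and "f 0 = 0" and "h 0 = 0"
    and "\<And>x y z. 0 \<le> \<phi> x y z"
    and "\<And>x y z. summable (control_term \<phi> x y z)"
    and "\<And>\<mu> x y. cmod \<mu> = 1 \<Longrightarrow>
      norm (2 *\<^sub>R f ((1 / 2) *\<^sub>R (\<mu> *\<^sub>C x + y)) - \<mu> *\<^sub>C f x - f y) \<le> \<phi> x y 0"
    and "\<And>\<mu> x y. cmod \<mu> = 1 \<Longrightarrow>
      norm (2 *\<^sub>R h ((1 / 2) *\<^sub>R (\<mu> *\<^sub>C x + y)) - \<mu> *\<^sub>C h x - h y) \<le> \<phi> x y 0"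
    and "\<And>x y z.
      norm (f \<lbrace>x, y, z\<rbrace> - \<lbrace>f x, h y, h z\<rbrace> - \<lbrace>h x, f y, h z\<rbrace> - \<lbrace>h x, h y, f z\<rbrace>) \<le> \<phi> x y z"
  shows "\<exists>D \<theta>.
    (Vector_Spaces.linear cscale cscale D \<and> Vector_Spaces.linear cscale cscale \<theta> \<and>
      (\<forall>x. norm (f x - D x) \<le>
        1 / 3 * (control_sum \<phi> x (- x) 0 + control_sum \<phi> (- x) (3 *\<^sub>R x) 0)) \<and>
      (\<forall>x. norm (h x - \<theta> x) \<le>
        1 / 3 * (control_sum \<phi> x (- x) 0 + control_sum \<phi> (- x) (3 *\<^sub>R x) 0))) \<and>
    (\<forall>D' \<theta>'.
      Vector_Spaces.linear cscale cscale D' \<and> Vector_Spaces.linear cscale cscale \<theta>' \<and>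
      (\<forall>x. norm (f x - D' x) \<le>
        1 / 3 * (control_sum \<phi> x (- x) 0 + control_sum \<phi> (- x) (3 *\<^sub>R x) 0)) \<and>
      (\<forall>x. norm (h x - \<theta>' x) \<le>
        1 / 3 * (control_sum \<phi> x (- x) 0 + control_sum \<phi> (- x) (3 *\<^sub>R x) 0)) \<longrightarrow>
      D' = D \<and> \<theta>' = \<theta>) \<and>
    theta_derivation cscale triple \<theta> D"
proof -
  interpret jb_star_triple cscale triple by fact
  note lim = tendsto_linear_approximation[where \<phi> = \<phi>, OF assms(5)]
  obtain D where D: "Vector_Spaces.linear cscale cscale D" "approximates \<phi> f D"
    using ex_linear_approximation[where \<phi> = \<phi>, OF assms(2,5,6)] by blast
  obtain \<theta> where \<theta>: "Vector_Spaces.linear cscale cscale \<theta>" "approximates \<phi> h \<theta>"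
    using ex_linear_approximation[where \<phi> = \<phi>, OF assms(3,5,7)] by blast
  \<comment> \<open>Both maps are pointwise limits of the one sequence built from \<open>g\<close>;
    taking \<open>g\<close> as \<open>f\<close> and as \<open>h\<close> settles the two components
    of the pair separately.\<close>
  have unique: "T' = T"
    if "Vector_Spaces.linear cscale cscale T" "approximates \<phi> g T"
      and "Vector_Spaces.linear cscale cscale T'" "approximates \<phi> g T'" for g T T'
    using LIMSEQ_unique[OF lim[OF that(3,4)] lim[OF that(1,2)]] by blast
  have "theta_derivation cscale triple \<theta> D"
    unfolding theta_derivation_def
    using D(1) \<theta>(1)
      derivation_identity_of_limits[where \<phi> = \<phi>, OF assms(4,5,8) lim[OF D] lim[OF \<theta>]]
    by blast
  then show ?thesis
    unfolding approximates_def[symmetric] using D \<theta> unique by blast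
qed

end
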